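(* (Integration by parts.) Let $\Bbbk$ be a field, $A$ a $\Bbbk$-algebra, and let $\Lambda$ be the integral on $A$ relative to a free right twisted multi-derivation $(\partial:A\to A^n,\sigma;\bar\sigma,\hat\sigma)$. Put $\partial_i^\sigma:=\sum_{j,k}\bar\sigma_{kj}\circ\partial_j\circ\hat\sigma_{ki}$. Then, for all $i=1,2,\ldots,n$ and $a,b\in A$, $$\Lambda\big(a\,\partial_i^\sigma(b)\big)=-\sum_l\Lambda\big(\partial_l^\sigma(a)\,\hat\sigma_{li}(b)\big).$$
   Context: All algebras are associative and unital over $\Bbbk$. $\mathrm{Hom}_A$ denotes right $A$-module maps. For $\sigma:A\to M_n(A)$ write $\sigma(a)=(\sigma_{ij}(a))$; for $\partial:A\to A^n$ write $\partial(a)=(\partial_i(a))$. Right twisted multi-derivation: a pair $(\partial,\sigma)$ of $\Bbbk$-linear maps $\partial:A\to A^n$, $\sigma:A\to M_n(A)$ with $\partial_i(ab)=\sum_j\partial_j(a)\sigma_{ji}(b)+a\partial_i(b)$ for all $a,b\in A$, $i=1,\ldots,n$. Free right twisted multi-derivation $(\partial,\sigma;\bar\sigma,\hat\sigma)$: a right twisted multi-derivation $(\partial,\sigma)$ in which $\sigma$ is a unital algebra map, together with an algebra map $\bar\sigma:A\to M_n(A)$ and a $\Bbbk$-linear map $\hat\sigma:A\to M_n(A)$ such that for all $a\in A$ and all $i,j$: $$\sum_k\bar\sigma_{ik}(\sigma_{jk}(a))=\delta_{ij}a,\quad \sum_k\sigma_{ki}(\bar\sigma_{kj}(a))=\delta_{ij}a,\quad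 \sum_k\hat\sigma_{ik}(\bar\sigma_{jk}(a))=\delta_{ij}a,\quad \sum_k\bar\sigma_{ki}(\hat\sigma_{kj}(a))=\delta_{ij}a.$$ The associated first order differential calculus $\Omega^1(A)$ is the free left $A$-module with basis $\omega_1,\ldots,\omega_n$, with right action determined by $\omega_i a=\sum_j\sigma_{ij}(a)\omega_j$, and differential $da=\sum_i\partial_i(a)\omega_i$. The associated divergence is $$\nabla:\mathrm{Hom}_A(\Omega^1(A),A)\to A,\qquad f\mapsto\sum_i\partial_i^\sigma(f(\omega_i)).$$ The integral on $A$ relative to $(\partial,\sigma;\bar\sigma,\hat\sigma)$ is the cokernel map $\Lambda:A\to\mathrm{coker}\,\nabla=A/\mathrm{im}\,\nabla$ (a $\Bbbk$-linear quotient map). *)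

theory Defs
  imports "HOL-Analysis.Finite_Cartesian_Product" "HOL-Library.Set_Algebras"
begin

text \<open>
  The sort \<open>{ring, monoid_mult}\<close> is that of unital rings; in contrast to \<open>ring_1\<close> it does
  not exclude the zero ring.
\<close>

locale k_algebra = vector_space smul
  for smul :: "'k::field \<Rightarrow> 'a::{ring, monoid_mult} \<Rightarrow> 'a" +
  assumes scale_mult_left: "smul c x * y = smul c (x * y)"
    and mult_scale_right: "x * smul c y = smul c (x * y)"

definition vec_scale :: "('k \<Rightarrow> 'a \<Rightarrow> 'a) \<Rightarrow> 'k \<Rightarrow> 'a ^ 'n \<Rightarrow> 'a ^ 'n"
  where "vec_scale smul c v = (\<chi> i. smul c (v $ i))"

definition mat_scale :: "('k \<Rightarrow> 'a \<Rightarrow> 'a) \<Rightarrow> 'k \<Rightarrow> 'a ^ 'n ^ 'n \<Rightarrow> 'a ^ 'n ^ 'n"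
  where "mat_scale smul c M = (\<chi> i j. smul c (M $ i $ j))"

text \<open>
  The entry \<open>\<sigma>\<^sub>i\<^sub>j(a)\<close> of a matrix-valued map is \<open>\<sigma> a $ i $ j\<close>. The matrix product is
  defined here because the library's \<open>**\<close> needs \<open>semiring_1\<close>, i.e. \<open>0 \<noteq> 1\<close>.
\<close>

definition mat_prod :: "'a::ring ^ 'n ^ 'n \<Rightarrow> 'a ^ 'n ^ 'n \<Rightarrow> 'a ^ 'n ^ 'n"
  where "mat_prod M N = (\<chi> i j. \<Sum>k\<in>UNIV. M $ i $ k * N $ k $ j)"

definition matrix_algebra_map ::
  "('k::field \<Rightarrow> 'a::{ring, monoid_mult} \<Rightarrow> 'a) \<Rightarrow> ('a \<Rightarrow> 'a ^ 'n ^ 'n) \<Rightarrow> bool"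
  where "matrix_algebra_map smul \<phi> \<longleftrightarrow>
    Vector_Spaces.linear smul (mat_scale smul) \<phi> \<and>
    \<phi> 1 = mat 1 \<and>
    (\<forall>a b. \<phi> (a * b) = mat_prod (\<phi> a) (\<phi> b))"

definition right_twisted_multi_derivation ::
  "('k::field \<Rightarrow> 'a::{ring, monoid_mult} \<Rightarrow> 'a) \<Rightarrow> ('a \<Rightarrow> 'a ^ 'n) \<Rightarrow> ('a \<Rightarrow> 'a ^ 'n ^ 'n) \<Rightarrow> bool"
  where "right_twisted_multi_derivation smul D \<sigma> \<longleftrightarrow>
    Vector_Spaces.linear smul (vec_scale smul) D \<and>
    Vector_Spaces.linear smul (mat_scale smul) \<sigma> \<and>
    (\<forall>a b i. D (a * b) $ i = (\<Sum>j\<in>UNIV. D a $ j * \<sigma> b $ j $ i) + a * D b $ i)"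

definition free_right_twisted_multi_derivation ::
  "('k::field \<Rightarrow> 'a::{ring, monoid_mult} \<Rightarrow> 'a) \<Rightarrow> ('a \<Rightarrow> 'a ^ 'n) \<Rightarrow> ('a \<Rightarrow> 'a ^ 'n ^ 'n) \<Rightarrow>
    ('a \<Rightarrow> 'a ^ 'n ^ 'n) \<Rightarrow> ('a \<Rightarrow> 'a ^ 'n ^ 'n) \<Rightarrow> bool"
  where "free_right_twisted_multi_derivation smul D \<sigma> \<sigma>bar \<sigma>hat \<longleftrightarrow>
    right_twisted_multi_derivation smul D \<sigma> \<and>
    matrix_algebra_map smul \<sigma> \<and>
    matrix_algebra_map smul \<sigma>bar \<and>
    Vector_Spaces.linear smul (mat_scale smul) \<sigma>hat \<and>
    (\<forall>a i j. (\<Sum>k\<in>UNIV. \<sigma>bar (\<sigma> a $ j $ k) $ i $ k) = (if i = j then a else 0)) \<and>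
    (\<forall>a i j. (\<Sum>k\<in>UNIV. \<sigma> (\<sigma>bar a $ k $ j) $ k $ i) = (if i = j then a else 0)) \<and>
    (\<forall>a i j. (\<Sum>k\<in>UNIV. \<sigma>hat (\<sigma>bar a $ j $ k) $ i $ k) = (if i = j then a else 0)) \<and>
    (\<forall>a i j. (\<Sum>k\<in>UNIV. \<sigma>bar (\<sigma>hat a $ k $ j) $ k $ i) = (if i = j then a else 0))"

definition twisted_partial ::
  "('a \<Rightarrow> 'a::{ring, monoid_mult} ^ 'n) \<Rightarrow> ('a \<Rightarrow> 'a ^ 'n ^ 'n) \<Rightarrow> ('a \<Rightarrow> 'a ^ 'n ^ 'n) \<Rightarrow>
    'n \<Rightarrow> 'a \<Rightarrow> 'a"
  where "twisted_partial D \<sigma>bar \<sigma>hat i a =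
    (\<Sum>j\<in>UNIV. \<Sum>k\<in>UNIV. \<sigma>bar (D (\<sigma>hat a $ k $ i) $ j) $ k $ j)"

text \<open>
  The free left module \<open>\<Omega>\<^sup>1(A)\<close> is the coordinate module \<open>'a ^ 'n\<close> with left action \<open>*s\<close>: the
  vector \<open>v\<close> stands for \<open>\<Sum>\<^sub>i v\<^sub>i \<omega>\<^sub>i\<close>. Its right action extends
  \<open>\<omega>\<^sub>i a = \<Sum>\<^sub>j \<sigma>\<^sub>i\<^sub>j(a) \<omega>\<^sub>j\<close> left linearly.
\<close>

definition omega :: "'n::finite \<Rightarrow> 'a::{ring, monoid_mult} ^ 'n"
  where "omega i = axis i 1"

definition right_act ::
  "('a::{ring, monoid_mult} \<Rightarrow> 'a ^ 'n ^ 'n) \<Rightarrow> 'a ^ 'n \<Rightarrow> 'a \<Rightarrow> 'a ^ 'n"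
  where "right_act \<sigma> v a = (\<Sum>i\<in>UNIV. v $ i *s (\<Sum>j\<in>UNIV. \<sigma> a $ i $ j *s omega j))"

lemma omega_expansion: "(v :: 'a::{ring, monoid_mult} ^ 'n) = (\<Sum>i\<in>UNIV. v $ i *s omega i)"
  by (simp add: vec_eq_iff omega_def axis_def if_distrib cong: if_cong)

lemma omega_right_act: "right_act \<sigma> (omega i) a = (\<Sum>j\<in>UNIV. \<sigma> a $ i $ j *s omega j)"
proof -
  have *: "omega i $ j *s w = (if j = i then w else 0)" for j and w :: "'a::{ring, monoid_mult} ^ 'n"
    by (simp add: vec_eq_iff omega_def axis_def)
  show ?thesis
    unfolding right_act_def * by simp
qed

text \<open>
  Right \<open>A\<close>-module maps \<open>\<Omega>\<^sup>1(A) \<rightarrow> A\<close>. They are \<open>k\<close>-linear automatically, since \<open>A\<close> is unital and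
  \<open>\<sigma>\<close> is \<open>k\<close>-linear and unital.
\<close>

definition Hom_Omega ::
  "('a::{ring, monoid_mult} \<Rightarrow> 'a ^ 'n ^ 'n) \<Rightarrow> ('a ^ 'n \<Rightarrow> 'a) set"
  where "Hom_Omega \<sigma> =
    {f. (\<forall>v w. f (v + w) = f v + f w) \<and> (\<forall>v a. f (right_act \<sigma> v a) = f v * a)}"

definition divergence ::
  "('a \<Rightarrow> 'a::{ring, monoid_mult} ^ 'n) \<Rightarrow> ('a \<Rightarrow> 'a ^ 'n ^ 'n) \<Rightarrow> ('a \<Rightarrow> 'a ^ 'n ^ 'n) \<Rightarrow>
    ('a ^ 'n \<Rightarrow> 'a) \<Rightarrow> 'a"
  where "divergence D \<sigma>bar \<sigma>hat f = (\<Sum>i\<in>UNIV. twisted_partial D \<sigma>bar \<sigma>hat i (f (omega i)))"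

definition im_divergence ::
  "('a \<Rightarrow> 'a::{ring, monoid_mult} ^ 'n) \<Rightarrow> ('a \<Rightarrow> 'a ^ 'n ^ 'n) \<Rightarrow> ('a \<Rightarrow> 'a ^ 'n ^ 'n) \<Rightarrow>
    ('a \<Rightarrow> 'a ^ 'n ^ 'n) \<Rightarrow> 'a set"
  where "im_divergence D \<sigma> \<sigma>bar \<sigma>hat = divergence D \<sigma>bar \<sigma>hat ` Hom_Omega \<sigma>"

text \<open>
  The cokernel \<open>A / im \<nabla>\<close> is the set of cosets of \<open>im \<nabla>\<close> in \<open>A\<close>, and \<open>\<Lambda>\<close> sends \<open>a\<close> to its coset.
  Cosets are added elementwise, by the addition of sets from \<^theory>\<open>HOL-Library.Set_Algebras\<close>. The
  neutral element \<open>{0}\<close> of that addition is not the zero of the quotient, so a sum \<open>\<Sum>\<close> of cosets is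
  their sum in the quotient only over a nonempty index set; below, sums range over the type \<open>'n\<close>.
  The negative is also taken elementwise; the class operation \<open>-\<close> on sets is the complement.
\<close>

definition integral_map ::
  "('a \<Rightarrow> 'a::{ring, monoid_mult} ^ 'n) \<Rightarrow> ('a \<Rightarrow> 'a ^ 'n ^ 'n) \<Rightarrow> ('a \<Rightarrow> 'a ^ 'n ^ 'n) \<Rightarrow>
    ('a \<Rightarrow> 'a ^ 'n ^ 'n) \<Rightarrow> 'a \<Rightarrow> 'a set"
  where "integral_map D \<sigma> \<sigma>bar \<sigma>hat a = a +o im_divergence D \<sigma> \<sigma>bar \<sigma>hat"

definition coset_neg :: "'a::ab_group_add set \<Rightarrow> 'a set"
  where "coset_neg X = uminus ` X"

context k_algebra
begin

lemma subspace_coset_eq_iff: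
  assumes "subspace H"
  shows "a +o H = b +o H \<longleftrightarrow> a - b \<in> H"
proof
  assume "a +o H = b +o H"
  moreover have "a \<in> a +o H"
    using subspace_0[OF assms] by (force simp: elt_set_plus_def)
  ultimately show "a - b \<in> H"
    by (auto simp: elt_set_plus_def)
next
  assume d: "a - b \<in> H"
  show "a +o H = b +o H"
  proof (intro equalityI subsetI)
    fix x assume "x \<in> a +o H"
    then obtain h where "h \<in> H" "x = a + h" by (auto simp: elt_set_plus_def)
    then show "x \<in> b +o H"
      using subspace_add[OF assms d, of h]
      by (auto simp: elt_set_plus_def algebra_simps intro!: bexI[of _ "a - b + h"])
  next
    fix x assume "x \<in> b +o H"
    then obtain h where "h \<in> H" "x = b + h" by (auto simp: elt_set_plus_def)
    then show "x \<in> a +o H"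
      using subspace_diff[OF assms _ d, of h]
      by (auto simp: elt_set_plus_def algebra_simps intro!: bexI[of _ "h - (a - b)"])
  qed
qed

lemma subspace_coset_add:
  assumes "subspace H"
  shows "(a +o H) + (b +o H) = (a + b) +o H"
proof (intro equalityI subsetI)
  fix x assume "x \<in> (a +o H) + (b +o H)"
  then obtain h k where "h \<in> H" "k \<in> H" "x = (a + h) + (b + k)"
    by (auto simp: elt_set_plus_def set_plus_def)
  then show "x \<in> (a + b) +o H"
    using subspace_add[OF assms, of h k]
    by (auto simp: elt_set_plus_def algebra_simps intro!: bexI[of _ "h + k"])
next
  fix x assume "x \<in> (a + b) +o H"
  then obtain h where "h \<in> H" "x = (a + h) + (b + 0)"
    by (auto simp: elt_set_plus_def algebra_simps)
  then show "x \<in> (a +o H) + (b +o H)"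
    using subspace_0[OF assms] by (auto simp: elt_set_plus_def set_plus_def)
qed

lemma subspace_coset_neg:
  assumes "subspace H"
  shows "coset_neg (a +o H) = (- a) +o H"
proof (intro equalityI subsetI)
  fix x assume "x \<in> coset_neg (a +o H)"
  then obtain h where "h \<in> H" "x = - a + - h"
    by (auto simp: elt_set_plus_def coset_neg_def)
  then show "x \<in> (- a) +o H"
    using subspace_neg[OF assms, of h] by (auto simp: elt_set_plus_def)
next
  fix x assume "x \<in> (- a) +o H"
  then obtain h where "h \<in> H" "x = - (a + - h)"
    by (auto simp: elt_set_plus_def)
  then show "x \<in> coset_neg (a +o H)"
    using subspace_neg[OF assms, of h] by (auto simp: elt_set_plus_def coset_neg_def intro!: image_eqI[of _ _ "a + - h"])
qed

lemma subspace_coset_sum: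
  assumes "subspace H" "finite I" "I \<noteq> {}"
  shows "(\<Sum>l\<in>I. f l +o H) = (\<Sum>l\<in>I. f l) +o H"
  using assms(2,3)
  by (induction I rule: finite_ne_induct) (simp_all add: subspace_coset_add[OF assms(1)])

lemma matrix_linear_entry:
  assumes "Vector_Spaces.linear smul (mat_scale smul) \<phi>"
  shows "\<phi> (smul c a) $ i $ j = smul c (\<phi> a $ i $ j)"
    and "\<phi> (a + b) $ i $ j = \<phi> a $ i $ j + \<phi> b $ i $ j"
proof -
  interpret \<phi>: Vector_Spaces.linear smul "mat_scale smul" \<phi> by (rule assms)
  show "\<phi> (smul c a) $ i $ j = smul c (\<phi> a $ i $ j)"
    by (simp add: \<phi>.scale mat_scale_def)
  show "\<phi> (a + b) $ i $ j = \<phi> a $ i $ j + \<phi> b $ i $ j"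
    by (simp add: \<phi>.add)
qed

lemma subspace_im_divergence:
  assumes "free_right_twisted_multi_derivation smul D \<sigma> \<sigma>bar \<sigma>hat"
  shows "subspace (im_divergence D \<sigma> \<sigma>bar \<sigma>hat)"
proof -
  have lin: "Vector_Spaces.linear smul (vec_scale smul) D"
    "Vector_Spaces.linear smul (mat_scale smul) \<sigma>bar"
    "Vector_Spaces.linear smul (mat_scale smul) \<sigma>hat"
    using assms by (auto simp: free_right_twisted_multi_derivation_def
        right_twisted_multi_derivation_def matrix_algebra_map_def)
  interpret D: Vector_Spaces.linear smul "vec_scale smul" D by (rule lin(1))
  have d: "D (smul c a) $ i = smul c (D a $ i)" "D (a + b) $ i = D a $ i + D b $ i" for c a b i
    by (simp_all add: D.scale D.add vec_scale_def)
  note simps = divergence_def twisted_partial_def matrix_linear_entry[OF lin(2)] matrix_linear_entry[OF lin(3)] d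
  have add: "divergence D \<sigma>bar \<sigma>hat (\<lambda>v. f v + g v) =
      divergence D \<sigma>bar \<sigma>hat f + divergence D \<sigma>bar \<sigma>hat g" for f g
    by (simp add: simps sum.distrib)
  have smul: "divergence D \<sigma>bar \<sigma>hat (\<lambda>v. smul c (f v)) = smul c (divergence D \<sigma>bar \<sigma>hat f)" for c f
    by (simp add: simps scale_sum_right)
  have Hom_scale: "(\<lambda>v. smul c (f v)) \<in> Hom_Omega \<sigma>" if "f \<in> Hom_Omega \<sigma>" for c f
    using that by (simp add: Hom_Omega_def scale_right_distrib scale_mult_left)
  have Hom_add: "(\<lambda>v. f v + g v) \<in> Hom_Omega \<sigma>" if "f \<in> Hom_Omega \<sigma>" "g \<in> Hom_Omega \<sigma>" for f g
    using that by (simp add: Hom_Omega_def algebra_simps)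
  have zero: "(\<lambda>v. 0) \<in> Hom_Omega \<sigma>"
    by (simp add: Hom_Omega_def)
  show ?thesis
  proof (rule subspaceI)
    have "divergence D \<sigma>bar \<sigma>hat (\<lambda>v. 0) = 0"
      using smul[of 0 "\<lambda>v. 0"] by simp
    then show "0 \<in> im_divergence D \<sigma> \<sigma>bar \<sigma>hat"
      unfolding im_divergence_def using zero by (metis image_eqI)
  next
    fix x y assume "x \<in> im_divergence D \<sigma> \<sigma>bar \<sigma>hat" "y \<in> im_divergence D \<sigma> \<sigma>bar \<sigma>hat"
    then show "x + y \<in> im_divergence D \<sigma> \<sigma>bar \<sigma>hat"
      unfolding im_divergence_def by (auto simp: add[symmetric] intro!: imageI Hom_add)
  next
    fix c x assume "x \<in> im_divergence D \<sigma> \<sigma>bar \<sigma>hat"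
    then show "smul c x \<in> im_divergence D \<sigma> \<sigma>bar \<sigma>hat"
      unfolding im_divergence_def by (auto simp: smul[symmetric] intro!: imageI Hom_scale)
  qed
qed

end

end

theory Submission
  imports Defs
begin

text \<open>
  The twisted partials \<open>\<partial>\<^sub>i\<^sup>\<sigma>\<close> obey a twisted Leibniz rule in which \<open>\<sigma>hat\<close> replaces \<open>\<sigma>\<close>:
  \<open>\<partial>\<^sub>i\<^sup>\<sigma>(a b) = \<Sum>\<^sub>l \<partial>\<^sub>l\<^sup>\<sigma>(a) \<sigma>hat\<^sub>l\<^sub>i(b) + a \<partial>\<^sub>i\<^sup>\<sigma>(b)\<close> (lemma \<open>twisted_partial_mult\<close>). Integration by parts says
  that the integral kills the left-hand side, that is, that \<open>\<partial>\<^sub>i\<^sup>\<sigma>(x)\<close> is always a divergence.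

  For the Leibniz rule, \<open>\<sigma>hat\<close> must be multiplicative. This is not part of the definition, but it
  follows from the inverse relations: they make \<open>x \<mapsto> (\<Sum>\<^sub>k \<sigma>bar\<^sub>k\<^sub>i(x\<^sub>k))\<^sub>i\<close> an injective map on
  tuples, and column \<open>j\<close> of \<open>\<sigma>hat(a b)\<close> and of \<open>\<sigma>hat(a) \<sigma>hat(b)\<close> have the same image under it.

  That \<open>\<partial>\<^sub>i\<^sup>\<sigma>(x)\<close> is a divergence comes from the relations between \<open>\<sigma>\<close> and \<open>\<sigma>bar\<close>: they imply
  \<open>a \<omega>\<^sub>i = \<Sum>\<^sub>j \<omega>\<^sub>j \<sigma>bar\<^sub>j\<^sub>i(a)\<close>, so that the \<open>\<omega>\<^sub>j\<close> also form a basis of the right module \<open>\<Omega>\<^sup>1(A)\<close>,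
  with coordinates \<open>v \<mapsto> \<Sum>\<^sub>i \<sigma>bar\<^sub>j\<^sub>i(v\<^sub>i)\<close>. Hence some right module map sends \<open>\<omega>\<^sub>i\<close> to \<open>x\<close> and the
  other basis elements to \<open>0\<close>, and its divergence is \<open>\<partial>\<^sub>i\<^sup>\<sigma>(x)\<close>.
\<close>

context k_algebra
begin

lemma matrix_linear_0:
  assumes "Vector_Spaces.linear smul (mat_scale smul) \<phi>"
  shows "\<phi> 0 $ i $ j = 0"
  using matrix_linear_entry(2)[OF assms, of 0 0] by simp

lemma matrix_linear_sum:
  assumes "Vector_Spaces.linear smul (mat_scale smul) \<phi>"
  shows "\<phi> (sum f S) $ i $ j = (\<Sum>s\<in>S. \<phi> (f s) $ i $ j)"
proof -
  interpret \<phi>: Vector_Spaces.linear smul "mat_scale smul" \<phi> by (rule assms)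
  show ?thesis by (simp add: \<phi>.sum)
qed

end

locale free_multi_derivation = k_algebra smul
  for smul :: "'k::field \<Rightarrow> 'a::{ring, monoid_mult} \<Rightarrow> 'a" +
  fixes D :: "'a \<Rightarrow> 'a ^ 'n"
    and \<sigma> \<sigma>bar \<sigma>hat :: "'a \<Rightarrow> 'a ^ 'n ^ 'n"
  assumes free: "free_right_twisted_multi_derivation smul D \<sigma> \<sigma>bar \<sigma>hat"
begin

lemma D_linear: "Vector_Spaces.linear smul (vec_scale smul) D"
  and \<sigma>bar_linear: "Vector_Spaces.linear smul (mat_scale smul) \<sigma>bar"
  and \<sigma>hat_linear: "Vector_Spaces.linear smul (mat_scale smul) \<sigma>hat"
  using free
  by (simp_all add: free_right_twisted_multi_derivation_def right_twisted_multi_derivation_def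
      matrix_algebra_map_def)

lemma D_0: "D 0 $ i = 0"
  and D_sum: "D (sum f S) $ i = (\<Sum>s\<in>S. D (f s) $ i)"
proof -
  interpret D: Vector_Spaces.linear smul "vec_scale smul" D by (rule D_linear)
  show "D 0 $ i = 0" "D (sum f S) $ i = (\<Sum>s\<in>S. D (f s) $ i)"
    by (simp_all add: D.zero D.sum)
qed

lemma D_mult: "D (a * b) $ i = (\<Sum>j\<in>UNIV. D a $ j * \<sigma> b $ j $ i) + a * D b $ i"
  using free by (simp add: free_right_twisted_multi_derivation_def right_twisted_multi_derivation_def)

lemmas \<sigma>bar_0 = matrix_linear_0[OF \<sigma>bar_linear]
  and \<sigma>bar_add = matrix_linear_entry(2)[OF \<sigma>bar_linear]
  and \<sigma>bar_sum = matrix_linear_sum[OF \<sigma>bar_linear]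
  and \<sigma>hat_0 = matrix_linear_0[OF \<sigma>hat_linear]
  and \<sigma>hat_sum = matrix_linear_sum[OF \<sigma>hat_linear]

lemma \<sigma>bar_1: "\<sigma>bar 1 $ i $ j = (if i = j then 1 else 0)"
  using free by (simp add: free_right_twisted_multi_derivation_def matrix_algebra_map_def mat_def)

lemma \<sigma>bar_mult: "\<sigma>bar (a * b) $ i $ j = (\<Sum>p\<in>UNIV. \<sigma>bar a $ i $ p * \<sigma>bar b $ p $ j)"
  using free
  by (simp add: free_right_twisted_multi_derivation_def matrix_algebra_map_def mat_prod_def)

lemma \<sigma>bar_\<sigma>: "(\<Sum>k\<in>UNIV. \<sigma>bar (\<sigma> a $ j $ k) $ i $ k) = (if i = j then a else 0)"
  and \<sigma>hat_\<sigma>bar: "(\<Sum>k\<in>UNIV. \<sigma>hat (\<sigma>bar a $ j $ k) $ i $ k) = (if i = j then a else 0)"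
  and \<sigma>bar_\<sigma>hat: "(\<Sum>k\<in>UNIV. \<sigma>bar (\<sigma>hat a $ k $ j) $ k $ i) = (if i = j then a else 0)"
  using free by (simp_all add: free_right_twisted_multi_derivation_def)

text \<open>
  A tuple \<open>x\<close> is recovered from the elements \<open>\<Sum>\<^sub>k \<sigma>bar\<^sub>k\<^sub>i(x\<^sub>k)\<close> by applying \<open>\<sigma>hat\<^sub>m\<^sub>i\<close> and summing over \<open>i\<close>.
\<close>

lemma \<sigma>bar_transpose_inject:
  assumes "\<And>i. (\<Sum>k\<in>UNIV. \<sigma>bar (x k) $ k $ i) = (\<Sum>k\<in>UNIV. \<sigma>bar (y k) $ k $ i)"
  shows "x m = y m"
proof -
  have recover: "(\<Sum>i\<in>UNIV. \<sigma>hat (\<Sum>k\<in>UNIV. \<sigma>bar (z k) $ k $ i) $ m $ i) = z m" for z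
  proof -
    have "(\<Sum>i\<in>UNIV. \<sigma>hat (\<Sum>k\<in>UNIV. \<sigma>bar (z k) $ k $ i) $ m $ i)
        = (\<Sum>k\<in>UNIV. \<Sum>i\<in>UNIV. \<sigma>hat (\<sigma>bar (z k) $ k $ i) $ m $ i)"
      unfolding \<sigma>hat_sum by (rule sum.swap)
    then show ?thesis by (simp add: \<sigma>hat_\<sigma>bar)
  qed
  show ?thesis using recover[of x] recover[of y] assms by simp
qed

lemma \<sigma>hat_mult: "\<sigma>hat (a * b) $ m $ j = (\<Sum>l\<in>UNIV. \<sigma>hat a $ m $ l * \<sigma>hat b $ l $ j)"
proof (rule \<sigma>bar_transpose_inject[where x = "\<lambda>k. \<sigma>hat (a * b) $ k $ j"
      and y = "\<lambda>k. \<Sum>l\<in>UNIV. \<sigma>hat a $ k $ l * \<sigma>hat b $ l $ j"])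
  fix i
  have "(\<Sum>k\<in>UNIV. \<sigma>bar (\<Sum>l\<in>UNIV. \<sigma>hat a $ k $ l * \<sigma>hat b $ l $ j) $ k $ i)
      = (\<Sum>k\<in>UNIV. \<Sum>l\<in>UNIV. \<Sum>p\<in>UNIV. \<sigma>bar (\<sigma>hat a $ k $ l) $ k $ p * \<sigma>bar (\<sigma>hat b $ l $ j) $ p $ i)"
    by (simp add: \<sigma>bar_sum \<sigma>bar_mult)
  also have "\<dots> = (\<Sum>l\<in>UNIV. \<Sum>k\<in>UNIV. \<Sum>p\<in>UNIV. \<sigma>bar (\<sigma>hat a $ k $ l) $ k $ p * \<sigma>bar (\<sigma>hat b $ l $ j) $ p $ i)"
    by (rule sum.swap)
  also have "\<dots> = (\<Sum>l\<in>UNIV. \<Sum>p\<in>UNIV. (\<Sum>k\<in>UNIV. \<sigma>bar (\<sigma>hat a $ k $ l) $ k $ p) * \<sigma>bar (\<sigma>hat b $ l $ j) $ p $ i)"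
    unfolding sum_distrib_right by (rule sum.cong[OF refl], rule sum.swap)
  also have "\<dots> = (\<Sum>l\<in>UNIV. a * \<sigma>bar (\<sigma>hat b $ l $ j) $ l $ i)"
    by (simp add: \<sigma>bar_\<sigma>hat if_distribR if_distrib[of "\<lambda>x. x * _"] cong: if_cong)
  also have "\<dots> = (if i = j then a * b else 0)"
    by (simp add: sum_distrib_left[symmetric] \<sigma>bar_\<sigma>hat)
  finally show "(\<Sum>k\<in>UNIV. \<sigma>bar (\<sigma>hat (a * b) $ k $ j) $ k $ i)
      = (\<Sum>k\<in>UNIV. \<sigma>bar (\<Sum>l\<in>UNIV. \<sigma>hat a $ k $ l * \<sigma>hat b $ l $ j) $ k $ i)"
    by (simp add: \<sigma>bar_\<sigma>hat)
qed

text \<open>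
  After \<open>\<sigma>hat\<close> and \<open>D\<close> have been expanded on the product, \<open>\<sigma>bar \<circ> \<sigma>\<close> cancels in the terms that
  differentiate \<open>a\<close>, and \<open>\<sigma>bar \<circ> \<sigma>hat\<close> cancels in the terms that differentiate \<open>b\<close>.
\<close>

lemma twisted_partial_mult:
  "twisted_partial D \<sigma>bar \<sigma>hat i (a * b) =
    (\<Sum>l\<in>UNIV. twisted_partial D \<sigma>bar \<sigma>hat l a * \<sigma>hat b $ l $ i) + a * twisted_partial D \<sigma>bar \<sigma>hat i b"
proof -
  have diff_a: "(\<Sum>j\<in>UNIV. \<Sum>m\<in>UNIV. \<sigma>bar (x m * \<sigma> y $ m $ j) $ k $ j) = (\<Sum>m\<in>UNIV. \<sigma>bar (x m) $ k $ m * y)"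
    for x :: "'n \<Rightarrow> 'a" and y k
  proof -
    have "(\<Sum>j\<in>UNIV. \<Sum>m\<in>UNIV. \<sigma>bar (x m * \<sigma> y $ m $ j) $ k $ j)
        = (\<Sum>m\<in>UNIV. \<Sum>j\<in>UNIV. \<Sum>p\<in>UNIV. \<sigma>bar (x m) $ k $ p * \<sigma>bar (\<sigma> y $ m $ j) $ p $ j)"
      unfolding \<sigma>bar_mult by (rule sum.swap)
    also have "\<dots> = (\<Sum>m\<in>UNIV. \<Sum>p\<in>UNIV. \<sigma>bar (x m) $ k $ p * (\<Sum>j\<in>UNIV. \<sigma>bar (\<sigma> y $ m $ j) $ p $ j))"
      unfolding sum_distrib_left by (rule sum.cong[OF refl], rule sum.swap)
    also have "\<dots> = (\<Sum>m\<in>UNIV. \<sigma>bar (x m) $ k $ m * y)"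
      by (simp add: \<sigma>bar_\<sigma> if_distrib[of "\<lambda>x. _ * x"] cong: if_cong)
    finally show ?thesis .
  qed
  have diff_b: "(\<Sum>k\<in>UNIV. \<sigma>bar (\<sigma>hat a $ k $ l * y) $ k $ j) = a * \<sigma>bar y $ l $ j" for l y j
  proof -
    have "(\<Sum>k\<in>UNIV. \<sigma>bar (\<sigma>hat a $ k $ l * y) $ k $ j)
        = (\<Sum>p\<in>UNIV. \<Sum>k\<in>UNIV. \<sigma>bar (\<sigma>hat a $ k $ l) $ k $ p * \<sigma>bar y $ p $ j)"
      unfolding \<sigma>bar_mult by (rule sum.swap)
    also have "\<dots> = a * \<sigma>bar y $ l $ j"
      by (simp add: sum_distrib_right[symmetric] \<sigma>bar_\<sigma>hat if_distrib[of "\<lambda>x. x * _"] cong: if_cong)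
    finally show ?thesis .
  qed
  have "twisted_partial D \<sigma>bar \<sigma>hat i (a * b) =
      (\<Sum>j\<in>UNIV. \<Sum>k\<in>UNIV. \<Sum>l\<in>UNIV. \<Sum>m\<in>UNIV. \<sigma>bar (D (\<sigma>hat a $ k $ l) $ m * \<sigma> (\<sigma>hat b $ l $ i) $ m $ j) $ k $ j)
      + (\<Sum>j\<in>UNIV. \<Sum>k\<in>UNIV. \<Sum>l\<in>UNIV. \<sigma>bar (\<sigma>hat a $ k $ l * D (\<sigma>hat b $ l $ i) $ j) $ k $ j)"
    by (simp add: twisted_partial_def \<sigma>hat_mult D_sum D_mult \<sigma>bar_sum \<sigma>bar_add sum.distrib)
  also have "(\<Sum>j\<in>UNIV. \<Sum>k\<in>UNIV. \<Sum>l\<in>UNIV. \<Sum>m\<in>UNIV. \<sigma>bar (D (\<sigma>hat a $ k $ l) $ m * \<sigma> (\<sigma>hat b $ l $ i) $ m $ j) $ k $ j)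
      = (\<Sum>k\<in>UNIV. \<Sum>l\<in>UNIV. \<Sum>j\<in>UNIV. \<Sum>m\<in>UNIV. \<sigma>bar (D (\<sigma>hat a $ k $ l) $ m * \<sigma> (\<sigma>hat b $ l $ i) $ m $ j) $ k $ j)"
    by (subst sum.swap, rule sum.cong[OF refl], rule sum.swap)
  also have "\<dots> = (\<Sum>k\<in>UNIV. \<Sum>l\<in>UNIV. \<Sum>m\<in>UNIV. \<sigma>bar (D (\<sigma>hat a $ k $ l) $ m) $ k $ m * \<sigma>hat b $ l $ i)"
    by (simp only: diff_a)
  also have "\<dots> = (\<Sum>l\<in>UNIV. \<Sum>k\<in>UNIV. \<Sum>m\<in>UNIV. \<sigma>bar (D (\<sigma>hat a $ k $ l) $ m) $ k $ m * \<sigma>hat b $ l $ i)"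
    by (rule sum.swap)
  also have "\<dots> = (\<Sum>l\<in>UNIV. \<Sum>m\<in>UNIV. \<Sum>k\<in>UNIV. \<sigma>bar (D (\<sigma>hat a $ k $ l) $ m) $ k $ m * \<sigma>hat b $ l $ i)"
    by (rule sum.cong[OF refl], rule sum.swap)
  also have "\<dots> = (\<Sum>l\<in>UNIV. twisted_partial D \<sigma>bar \<sigma>hat l a * \<sigma>hat b $ l $ i)"
    by (simp add: twisted_partial_def sum_distrib_right)
  also have "(\<Sum>j\<in>UNIV. \<Sum>k\<in>UNIV. \<Sum>l\<in>UNIV. \<sigma>bar (\<sigma>hat a $ k $ l * D (\<sigma>hat b $ l $ i) $ j) $ k $ j)
      = (\<Sum>j\<in>UNIV. \<Sum>l\<in>UNIV. \<Sum>k\<in>UNIV. \<sigma>bar (\<sigma>hat a $ k $ l * D (\<sigma>hat b $ l $ i) $ j) $ k $ j)"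
    by (rule sum.cong[OF refl], rule sum.swap)
  also have "\<dots> = a * twisted_partial D \<sigma>bar \<sigma>hat i b"
    by (simp add: diff_b twisted_partial_def sum_distrib_left)
  finally show ?thesis .
qed

lemma twisted_partial_0: "twisted_partial D \<sigma>bar \<sigma>hat i 0 = 0"
  by (simp add: twisted_partial_def \<sigma>hat_0 D_0 \<sigma>bar_0)

text \<open>
  Up to the left factor \<open>x\<close>, this is the coordinate of \<open>v\<close> at \<open>\<omega>\<^sub>j\<close> with respect to the \<open>\<omega>\<^sub>i\<close> as a basis
  of the right module.
\<close>

definition coordinate_map :: "'n \<Rightarrow> 'a \<Rightarrow> 'a ^ 'n \<Rightarrow> 'a"
  where "coordinate_map j x v = x * (\<Sum>i\<in>UNIV. \<sigma>bar (v $ i) $ j $ i)"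

lemma right_act_nth: "right_act \<sigma> v a $ k = (\<Sum>i\<in>UNIV. v $ i * \<sigma> a $ i $ k)"
  by (simp add: right_act_def omega_expansion[symmetric])

text \<open>
  Right linearity holds because \<open>\<sigma>bar\<close> is multiplicative and cancels the \<open>\<sigma>\<close> of the right action.
\<close>

lemma coordinate_map_in_Hom: "coordinate_map j x \<in> Hom_Omega \<sigma>"
proof -
  have "coordinate_map j x (right_act \<sigma> v a) = coordinate_map j x v * a" for v a
  proof -
    have "(\<Sum>k\<in>UNIV. \<sigma>bar (right_act \<sigma> v a $ k) $ j $ k)
        = (\<Sum>k\<in>UNIV. \<Sum>i\<in>UNIV. \<Sum>p\<in>UNIV. \<sigma>bar (v $ i) $ j $ p * \<sigma>bar (\<sigma> a $ i $ k) $ p $ k)"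
      by (simp add: right_act_nth \<sigma>bar_sum \<sigma>bar_mult)
    also have "\<dots> = (\<Sum>i\<in>UNIV. \<Sum>k\<in>UNIV. \<Sum>p\<in>UNIV. \<sigma>bar (v $ i) $ j $ p * \<sigma>bar (\<sigma> a $ i $ k) $ p $ k)"
      by (rule sum.swap)
    also have "\<dots> = (\<Sum>i\<in>UNIV. \<Sum>p\<in>UNIV. \<sigma>bar (v $ i) $ j $ p * (\<Sum>k\<in>UNIV. \<sigma>bar (\<sigma> a $ i $ k) $ p $ k))"
      unfolding sum_distrib_left by (rule sum.cong[OF refl], rule sum.swap)
    also have "\<dots> = (\<Sum>i\<in>UNIV. \<sigma>bar (v $ i) $ j $ i) * a"
      by (simp add: \<sigma>bar_\<sigma> sum_distrib_right if_distrib[of "\<lambda>x. _ * x"] cong: if_cong)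
    finally show ?thesis by (simp add: coordinate_map_def mult.assoc)
  qed
  then show ?thesis
    by (simp add: Hom_Omega_def coordinate_map_def \<sigma>bar_add sum.distrib distrib_left)
qed

lemma coordinate_map_omega: "coordinate_map j x (omega l) = (if l = j then x else 0)"
proof -
  have "\<sigma>bar (omega l $ i) $ j $ i = (if i = l then if j = l then 1 else 0 else 0)" for i
    by (simp add: omega_def axis_def \<sigma>bar_1 \<sigma>bar_0)
  then show ?thesis by (simp add: coordinate_map_def)
qed

lemma twisted_partial_in_im_divergence:
  "twisted_partial D \<sigma>bar \<sigma>hat j x \<in> im_divergence D \<sigma> \<sigma>bar \<sigma>hat"
proof -
  have "divergence D \<sigma>bar \<sigma>hat (coordinate_map j x) = twisted_partial D \<sigma>bar \<sigma>hat j x"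
    by (simp add: divergence_def coordinate_map_omega twisted_partial_0
        if_distrib[of "twisted_partial D \<sigma>bar \<sigma>hat _"] cong: if_cong)
  then show ?thesis
    unfolding im_divergence_def using coordinate_map_in_Hom by (metis image_eqI)
qed

end

theorem theorem2p13:
  fixes smul :: "'k::field \<Rightarrow> 'a::{ring, monoid_mult} \<Rightarrow> 'a"
    and D :: "'a \<Rightarrow> 'a ^ 'n"
    and \<sigma> \<sigma>bar \<sigma>hat :: "'a \<Rightarrow> 'a ^ 'n ^ 'n"
    and \<Lambda> :: "'a \<Rightarrow> 'a set"
    and D\<sigma> :: "'n \<Rightarrow> 'a \<Rightarrow> 'a"
  defines "\<Lambda> \<equiv> integral_map D \<sigma> \<sigma>bar \<sigma>hat"
    and "D\<sigma> \<equiv> twisted_partial D \<sigma>bar \<sigma>hat"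
  assumes "k_algebra smul"
    and "free_right_twisted_multi_derivation smul D \<sigma> \<sigma>bar \<sigma>hat"
  shows "\<forall>i a b. \<Lambda> (a * D\<sigma> i b) = coset_neg (\<Sum>l\<in>UNIV. \<Lambda> (D\<sigma> l a * \<sigma>hat b $ l $ i))"
proof (intro allI)
  fix i a b
  interpret free_multi_derivation smul D \<sigma> \<sigma>bar \<sigma>hat
    using assms(3,4) by (simp add: free_multi_derivation_def free_multi_derivation_axioms_def)
  note H = subspace_im_divergence[OF free]
  have "a * D\<sigma> i b - - (\<Sum>l\<in>UNIV. D\<sigma> l a * \<sigma>hat b $ l $ i) = D\<sigma> i (a * b)"
    unfolding D\<sigma>_def twisted_partial_mult by (simp add: add.commute)
  also have "\<dots> \<in> im_divergence D \<sigma> \<sigma>bar \<sigma>hat"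
    unfolding D\<sigma>_def by (rule twisted_partial_in_im_divergence)
  finally show "\<Lambda> (a * D\<sigma> i b) = coset_neg (\<Sum>l\<in>UNIV. \<Lambda> (D\<sigma> l a * \<sigma>hat b $ l $ i))"
    unfolding \<Lambda>_def integral_map_def
    by (simp add: subspace_coset_sum[OF H] subspace_coset_neg[OF H] subspace_coset_eq_iff[OF H])
qed

end
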